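(* Let $\nu=\nu_1\nu_2\cdots\nu_{k-1}$ be a word of distinct integers in $[k]$, let $r$ be the unique element of $[k]\setminus\{\nu_1,\ldots,\nu_{k-1}\}$, let $i\in[k-1]$, and let $n\ge 1$. Then: (i) if $\nu_i\notin\mathrm{Lmax}(\nu)$, then $\mathcal{S}_n(\nu;\,r\to\nu_i)=\mathcal{S}_n(\nu_1\cdots\nu_{i-1}\,\overline{r\nu_i}\,\nu_{i+1}\cdots\nu_{k-1})$; (ii) if $r<\max(\nu_1,\ldots,\nu_{i-1})$ (in particular $i\ge 2$), then $\mathcal{S}_n(\nu;\,\nu_i\to r)=\mathcal{S}_n(\nu_1\cdots\nu_{i-1}\,\overline{\nu_i r}\,\nu_{i+1}\cdots\nu_{k-1})$.
   Context: $[n]=\{1,\dots,n\}$, and $\mathcal{S}_n$ is the set of permutations $\pi=\pi_1\pi_2\cdots\pi_n$ of $[n]$ in one-line notation. For a word $w$ of distinct integers, $w_i$ is a left-to-right maximum if $w_i>w_j$ for all $j<i$; $\mathrm{Lmax}(w)$ is the set of all left-to-right maxima of $w$. The permutation $\hat\pi$: for $\pi\in\mathcal{S}_n$, $\hat\pi\in\mathcal{S}_n$ is the permutation whose cycle form is obtained from the word $\pi_1\cdots\pi_n$ by inserting a left parenthesis before each left-to-right maximum and a right parenthesis immediately before the next left-to-right maximum, or at the end of the word. A cycle $(c_1,c_2,\dots,c_s)$ means $c_1\mapsto c_2\mapsto\cdots\mapsto c_s\mapsto c_1$. Example: if $\pi=2537164$ then $\hat\pi=(2)(53)(7164)$. Arrow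 patterns: an arrow pattern of size $k$ is a pair $(\nu;H)$ where $\nu=\nu_1\cdots\nu_m$ is a word of distinct positive integers, $H$ is a collection of arrows $b_i\to c_i$, and the set of all integers appearing in $\nu$ or $H$ is $[k]$. A permutation $\pi\in\mathcal{S}_n$ contains $(\nu;H)$ if there are a set $X=\{x_1<x_2<\cdots<x_k\}\subseteq[n]$ and indices $t_1<\cdots<t_m$ such that $\pi_{t_1}\pi_{t_2}\cdots\pi_{t_m}=x_{\nu_1}x_{\nu_2}\cdots x_{\nu_m}$ and $\hat\pi(x_{b_i})=x_{c_i}$ for every arrow $b_i\to c_i$ in $H$. Otherwise $\pi$ avoids $(\nu;H)$. $\mathcal{S}_n(\nu;H)$ is the set of permutations in $\mathcal{S}_n$ avoiding $(\nu;H)$. Vincular patterns: a vincular pattern is a permutation $\sigma=\sigma_1\cdots\sigma_k$ of $[k]$ in which some adjacent entries are joined by an overline. An occurrence in $\pi$ is a subsequence $\pi_{t_1}\cdots\pi_{t_k}$ ($t_1<\cdots<t_k$) order-isomorphic to $\sigma$ such that entries corresponding to adjacent overlined entries $\sigma_j\sigma_{j+1}$ are consecutive in $\pi$, i.e. $t_{j+1}=t_j+1$. $\mathcal{S}_n(\sigma)$ is the set of permutations in $\mathcal{S}_n$ with no occurrence of $\sigma$. *)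

theory Defs
  imports "HOL-Combinatorics.Combinatorics"
begin

text \<open>
  A permutation of \<open>{1..n}\<close> in one-line notation is a list in \<open>permutations_of_set {1..n}\<close>, and
  more generally a word of distinct integers is a distinct list. Values are the numbers
  \<open>1, 2, \<dots>\<close> as usual, but positions in words are counted from \<open>0\<close>, as for \<open>(!)\<close>.
\<close>

definition Lmax :: "nat list \<Rightarrow> nat set" where
  "Lmax w = {w ! i | i. i < length w \<and> (\<forall>j<i. w ! j < w ! i)}"

text \<open>Cut a list immediately before each element satisfying \<open>P\<close> (except the first element, where
  there is nothing to cut).\<close>

function cut_before :: "('a \<Rightarrow> bool) \<Rightarrow> 'a list \<Rightarrow> 'a list list" where
  "cut_before P [] = []"
| "cut_before P (x # xs) =
     (x # takeWhile (\<lambda>y. \<not> P y) xs) # cut_before P (dropWhile (\<lambda>y. \<not> P y) xs)"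
  by pat_completeness auto
termination
  by (relation "measure (\<lambda>(P, xs). length xs)") (auto simp: length_dropWhile_le le_imp_less_Suc)

definition hat_cycles :: "nat list \<Rightarrow> nat list list" where
  "hat_cycles w = cut_before (\<lambda>x. x \<in> Lmax w) w"

text \<open>The map \<open>cycle_of_list [c\<^sub>1, \<dots>, c\<^sub>s]\<close> sends \<open>c\<^sub>1\<close> to \<open>c\<^sub>2\<close>, \dots, and \<open>c\<^sub>s\<close> to \<open>c\<^sub>1\<close>. The cycles
  are disjoint, so the order of composition does not matter.\<close>

definition hat :: "nat list \<Rightarrow> nat \<Rightarrow> nat" where
  "hat w = foldr (\<lambda>c f. cycle_of_list c \<circ> f) (hat_cycles w) id"

lemma concat_hat_cycles: "concat (hat_cycles w) = w"
proof -
  have "concat (cut_before P w) = w" for P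
    by (induction P w rule: cut_before.induct) auto
  then show ?thesis
    by (simp add: hat_cycles_def)
qed

lemma hat_cycles_example:
  "hat_cycles [2, 5, 3, 7, 1, 6, 4] = [[2], [5, 3], [7, 1, 6, 4]]"
proof -
  let ?w = "[2, 5, 3, 7, 1, 6, 4] :: nat list"
  have "Lmax ?w = (!) ?w ` set (filter (\<lambda>i. \<forall>j\<in>set [0..<i]. ?w ! j < ?w ! i) [0..<length ?w])"
    unfolding Lmax_def by (simp only: set_filter set_upt) fastforce
  also have "\<dots> = {2, 5, 7}"
    by code_simp
  finally have "Lmax ?w = {2, 5, 7}" .
  then show ?thesis
    by (simp add: hat_cycles_def)
qed

text \<open>An arrow pattern is a pair \<open>(\<nu>, H)\<close>; an arrow \<open>b \<rightarrow> c\<close> is the pair \<open>(b, c)\<close>.\<close>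

type_synonym arrow_pattern = "nat list \<times> (nat \<times> nat) set"

definition is_arrow_pattern :: "nat \<Rightarrow> arrow_pattern \<Rightarrow> bool" where
  "is_arrow_pattern k = (\<lambda>(\<nu>, H). distinct \<nu> \<and> set \<nu> \<union> fst ` H \<union> snd ` H = {1..k})"

text \<open>The function \<open>x\<close> enumerates the set \<open>X = {x 1 < \<dots> < x k}\<close>.\<close>

definition arrow_contains :: "nat \<Rightarrow> nat list \<Rightarrow> arrow_pattern \<Rightarrow> bool" where
  "arrow_contains k w = (\<lambda>(\<nu>, H). \<exists>x t :: nat \<Rightarrow> nat.
     strict_mono_on {1..k} x \<and> x ` {1..k} \<subseteq> {1..length w} \<and>
     strict_mono_on {..<length \<nu>} t \<and> t ` {..<length \<nu>} \<subseteq> {..<length w} \<and>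
     (\<forall>j<length \<nu>. w ! t j = x (\<nu> ! j)) \<and>
     (\<forall>(b, c)\<in>H. hat w (x b) = x c))"

definition arrow_avoiders :: "nat \<Rightarrow> nat \<Rightarrow> arrow_pattern \<Rightarrow> nat list set" where
  "arrow_avoiders n k p = {w \<in> permutations_of_set {1..n}. \<not> arrow_contains k w p}"

text \<open>A vincular pattern is a pair \<open>(\<sigma>, J)\<close>, where \<open>j \<in> J\<close> means that the adjacent entries
  \<open>\<sigma> ! j\<close> and \<open>\<sigma> ! Suc j\<close> are joined by an overline.\<close>

type_synonym vincular_pattern = "nat list \<times> nat set"

definition is_vincular_pattern :: "nat \<Rightarrow> vincular_pattern \<Rightarrow> bool" where
  "is_vincular_pattern k =
     (\<lambda>(\<sigma>, J). \<sigma> \<in> permutations_of_set {1..k} \<and> (\<forall>j\<in>J. Suc j < k))"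

definition vincular_contains :: "nat list \<Rightarrow> vincular_pattern \<Rightarrow> bool" where
  "vincular_contains w = (\<lambda>(\<sigma>, J). \<exists>t :: nat \<Rightarrow> nat.
     strict_mono_on {..<length \<sigma>} t \<and> t ` {..<length \<sigma>} \<subseteq> {..<length w} \<and>
     (\<forall>a<length \<sigma>. \<forall>b<length \<sigma>. w ! t a < w ! t b \<longleftrightarrow> \<sigma> ! a < \<sigma> ! b) \<and>
     (\<forall>j\<in>J. t (Suc j) = Suc (t j)))"

definition vincular_avoiders :: "nat \<Rightarrow> vincular_pattern \<Rightarrow> nat list set" where
  "vincular_avoiders n p = {w \<in> permutations_of_set {1..n}. \<not> vincular_contains w p}"

lemma patterns_wellformed:
  assumes "distinct \<nu>" "set \<nu> \<subseteq> {1..k}" "length \<nu> = k - 1" "{1..k} - set \<nu> = {r}" "i < k - 1"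
  shows "is_arrow_pattern k (\<nu>, {(r, \<nu> ! i)})" "is_arrow_pattern k (\<nu>, {(\<nu> ! i, r)})"
    and "is_vincular_pattern k (take i \<nu> @ [r, \<nu> ! i] @ drop (Suc i) \<nu>, {i})"
    "is_vincular_pattern k (take i \<nu> @ [\<nu> ! i, r] @ drop (Suc i) \<nu>, {i})"
proof -
  have i: "i < length \<nu>" using assms by simp
  define a b where "a = take i \<nu>" and "b = drop (Suc i) \<nu>"
  have eq: "\<nu> = a @ \<nu> ! i # b"
    unfolding a_def b_def using i by (rule id_take_nth_drop)
  have "set \<nu> = insert (\<nu> ! i) (set a \<union> set b)"
    by (subst eq) simp
  moreover have all: "insert r (set \<nu>) = {1..k}" and r: "r \<notin> set \<nu>"
    using assms(2,4) by blast+
  ultimately have letters: "{1..k} = insert r (insert (\<nu> ! i) (set a \<union> set b))"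
    and r': "r \<notin> insert (\<nu> ! i) (set a \<union> set b)"
    by simp_all
  have dist: "distinct (a @ \<nu> ! i # b)"
    using assms(1) eq by metis
  have ins: "insert (\<nu> ! i) (set \<nu>) = set \<nu>"
    using i by (simp add: insert_absorb)
  show "is_arrow_pattern k (\<nu>, {(r, \<nu> ! i)})" "is_arrow_pattern k (\<nu>, {(\<nu> ! i, r)})"
    using assms(1) by (simp_all add: is_arrow_pattern_def all[symmetric] ins insert_commute
        del: One_nat_def)
  have "set a \<union> insert r (insert (\<nu> ! i) (set b)) = {1..k}"
    "set a \<union> insert (\<nu> ! i) (insert r (set b)) = {1..k}"
    unfolding letters by blast+
  then show "is_vincular_pattern k (take i \<nu> @ [r, \<nu> ! i] @ drop (Suc i) \<nu>, {i})"
    "is_vincular_pattern k (take i \<nu> @ [\<nu> ! i, r] @ drop (Suc i) \<nu>, {i})"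
    using dist r' assms(5)
    by (simp_all add: is_vincular_pattern_def permutations_of_set_def a_def[symmetric] b_def[symmetric]
        del: One_nat_def)
qed

end

theory Submission
  imports Defs
begin

text \<open>
  If \<open>a\<close> is not the last letter of its cycle in \<open>hat w\<close>, then \<open>hat w a\<close> is the letter following
  \<open>a\<close> in \<open>w\<close>; otherwise \<open>hat w a\<close> is the first letter of the cycle, which is a left-to-right
  maximum and dominates everything up to \<open>a\<close>. Hence a letter larger than \<open>hat w a\<close> to the left of
  \<open>a\<close> or of \<open>hat w a\<close> rules out the second case. In both parts of the theorem the pattern \<open>\<nu>\<close>
  provides such a letter, so the arrow says exactly that two letters are adjacent.
\<close>

section \<open>Left-to-right maxima of a word\<close>

lemma Lmax_greatest_prefix:
  assumes "p < length w"
  obtains s where "s \<le> p" "w ! s \<in> Lmax w" "\<forall>j\<le>p. w ! j \<le> w ! s"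
proof -
  define M where "M = Max ((!) w ` {..p})"
  have fin: "finite ((!) w ` {..p})" by simp
  have "M \<in> (!) w ` {..p}"
    unfolding M_def by (rule Max_in[OF fin]) auto
  then have ex: "\<exists>s. s \<le> p \<and> w ! s = M" by auto
  \<comment> \<open>\<open>LEAST\<close> selects the first position at which the maximum of the
    prefix occurs, so all letters before it are strictly smaller and \<open>w ! s\<close> is a
    left-to-right maximum.\<close>
  define s where "s = (LEAST s. s \<le> p \<and> w ! s = M)"
  have s: "s \<le> p" "w ! s = M"
    using LeastI_ex[OF ex] by (simp_all add: s_def)
  have le: "w ! j \<le> M" if "j \<le> p" for j
    unfolding M_def using that by (intro Max_ge[OF fin]) auto
  have "w ! j < w ! s" if "j < s" for j
  proof -
    have "j \<le> p" "w ! j \<noteq> M"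
      using that s(1) not_less_Least[of j "\<lambda>s. s \<le> p \<and> w ! s = M", folded s_def] by auto
    then show ?thesis using le[of j] s(2) by simp
  qed
  then have "w ! s \<in> Lmax w"
    unfolding Lmax_def using s assms by auto
  with s le show ?thesis by (intro that) auto
qed

lemma Lmax_less:
  assumes "distinct w" "s < length w" "w ! s \<in> Lmax w" "j < s"
  shows "w ! j < w ! s"
  using assms by (auto simp: Lmax_def nth_eq_iff_index_eq)

section \<open>Cycle blocks and their product\<close>

text \<open>\<open>takeWhile\<close> stops at the first letter satisfying \<open>P\<close>, so a
  block has no such letter after its head, and each cut is made at one. The guards on
  \<open>pre\<close> and \<open>post\<close> exempt the two ends of the word, where a block begins
  or stops without a cut.\<close>

lemma cut_before_block:
  assumes "c \<in> set (cut_before P w)"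
  obtains pre post where "w = pre @ c @ post" "c \<noteq> []" "\<forall>y\<in>set (tl c). \<not> P y"
    "pre \<noteq> [] \<longrightarrow> P (hd c)" "post \<noteq> [] \<longrightarrow> P (hd post)"
proof -
  have "\<exists>pre post. w = pre @ c @ post \<and> c \<noteq> [] \<and> (\<forall>y\<in>set (tl c). \<not> P y) \<and>
    (pre \<noteq> [] \<longrightarrow> P (hd c)) \<and> (post \<noteq> [] \<longrightarrow> P (hd post))"
    using assms
  proof (induction P w rule: cut_before.induct)
    case (1 P)
    then show ?case by simp
  next
    case (2 P x xs)
    let ?h = "x # takeWhile (\<lambda>y. \<not> P y) xs" and ?r = "dropWhile (\<lambda>y. \<not> P y) xs"
    have r: "?r \<noteq> [] \<Longrightarrow> P (hd ?r)"
      using hd_dropWhile[of "\<lambda>y. \<not> P y" xs] by simp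
    show ?case
    proof (cases "c = ?h")
      case True
      then show ?thesis
        using r by (intro exI[of _ "[]"] exI[of _ ?r]) (auto dest: set_takeWhileD)
    next
      case False
      then have "c \<in> set (cut_before P ?r)" using 2(2) by simp
      from 2(1)[OF this] obtain pre post where *: "?r = pre @ c @ post" "c \<noteq> []"
        "\<forall>y\<in>set (tl c). \<not> P y" "pre \<noteq> [] \<longrightarrow> P (hd c)" "post \<noteq> [] \<longrightarrow> P (hd post)"
        by blast
      \<comment> \<open>In the whole word something precedes \<open>c\<close> even when
        \<open>pre\<close> is empty; then \<open>c\<close> opens the remainder \<open>?r\<close>,
        whose first letter satisfies \<open>P\<close>.\<close>
      have "P (hd c)"
        using * r by (cases "pre = []") auto
      moreover have "x # xs = (?h @ pre) @ c @ post"
        using *(1) takeWhile_dropWhile_id[of "\<lambda>y. \<not> P y" xs] by simp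
      ultimately show ?thesis
        using * by blast
    qed
  qed
  then show ?thesis using that by blast
qed

text \<open>The cycles share no letters and \<open>cycle_of_list c\<close> maps \<open>set c\<close>
  to itself, so all the other factors fix both \<open>x\<close> and its image under
  \<open>c\<close>.\<close>

lemma foldr_cycles_eq:
  fixes cs :: "'a list list"
  assumes "distinct (concat cs)" "c \<in> set cs" "x \<in> set c"
  shows "foldr (\<lambda>c f. cycle_of_list c \<circ> f) cs id x = cycle_of_list c x"
proof -
  let ?F = "foldr (\<lambda>c f. cycle_of_list c \<circ> f)"
  have out: "?F cs id x = x" if "x \<notin> set (concat cs)" for cs :: "'a list list" and x
    using that by (induction cs) (auto simp: id_outside_supp)
  have perm: "cycle_of_list c x \<in> set c" if "x \<in> set c" for c :: "'a list" and x
    using that cycle_permutes[of c] by (simp add: permutes_in_image)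
  show ?thesis
    using assms
  proof (induction cs)
    case Nil
    then show ?case by simp
  next
    case (Cons d cs)
    show ?case
    proof (cases "x \<in> set d")
      case True
      then have "d = c" "x \<notin> set (concat cs)" using Cons.prems by auto
      have "?F (d # cs) id x = cycle_of_list d (?F cs id x)" by simp
      also have "?F cs id x = x" by (rule out) fact
      finally show ?thesis using \<open>d = c\<close> by (simp only:)
    next
      case False
      then have c: "c \<in> set cs" using Cons.prems by auto
      then have "cycle_of_list c x \<notin> set d"
        using perm[OF Cons.prems(3)] Cons.prems(1) by auto
      with c show ?thesis
        using Cons by (simp add: id_outside_supp)
    qed
  qed
qed

text \<open>Applying a cycle to each letter of its own list rotates the list by one place; the
  rotated list is then read at position \<open>q\<close>.\<close>

lemma cycle_of_list_nth:
  assumes "distinct c" "q < length c"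
  shows "cycle_of_list c (c ! q) = (if Suc q < length c then c ! Suc q else hd c)"
proof -
  have "map (cycle_of_list c ^^ 1) c = rotate 1 c"
    by (rule cyclic_rotation) (use assms in simp)
  then have "map (cycle_of_list c) c ! q = rotate1 c ! q"
    by simp
  then have "cycle_of_list c (c ! q) = rotate1 c ! q"
    using assms by simp
  then show ?thesis
    using assms(2) by (cases c) (auto simp: nth_append not_less less_Suc_eq)
qed

section \<open>Values of \<open>hat\<close> and adjacency\<close>

text \<open>The alternatives are that \<open>p\<close> lies inside its cycle or at its end. At the
  end the image is the head of the cycle. The maximum of the prefix up to \<open>p\<close> is itself
  a left-to-right maximum, hence not in the tail of the block, and it cannot precede the block; so
  it is that head.\<close>

lemma hat_nth:
  assumes w: "distinct w" "p < length w"
  shows "Suc p < length w \<and> w ! Suc p \<notin> Lmax w \<and> hat w (w ! p) = w ! Suc p \<or>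
    (Suc p < length w \<longrightarrow> w ! Suc p \<in> Lmax w) \<and> hat w (w ! p) \<in> Lmax w \<and>
      (\<forall>j\<le>p. w ! j \<le> hat w (w ! p))"
proof -
  have conc: "concat (hat_cycles w) = w" by (rule concat_hat_cycles)
  have "w ! p \<in> set (concat (hat_cycles w))"
    using w by (simp add: conc)
  then obtain c where c: "c \<in> set (hat_cycles w)" "w ! p \<in> set c"
    by auto
  then obtain q where q: "q < length c" "w ! p = c ! q"
    by (metis in_set_conv_nth)
  obtain pre post where b: "w = pre @ c @ post" "c \<noteq> []" "\<forall>y\<in>set (tl c). y \<notin> Lmax w"
    "pre \<noteq> [] \<longrightarrow> hd c \<in> Lmax w" "post \<noteq> [] \<longrightarrow> hd post \<in> Lmax w"
    using cut_before_block[OF c(1)[unfolded hat_cycles_def]] by metis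
  have dc: "distinct c" using w b(1) by (metis distinct_append)
  have nth: "w ! (length pre + m) = c ! m" if "m < length c" for m
    using that by (simp add: b(1) nth_append)
  have "w ! p = w ! (length pre + q)" "length pre + q < length w"
    using q nth[OF q(1)] by simp_all (simp add: b(1))
  then have p: "p = length pre + q"
    using w by (simp add: nth_eq_iff_index_eq)
  have tl: "c ! m \<notin> Lmax w" if "0 < m" "m < length c" for m
  proof -
    have "c ! m = tl c ! (m - 1)" "m - 1 < length (tl c)"
      using that by (simp_all add: nth_tl)
    then show ?thesis using b(3) by (metis nth_mem)
  qed
  have "hat w (w ! p) = cycle_of_list c (w ! p)"
    unfolding hat_def using c w by (intro foldr_cycles_eq) (simp_all add: conc)
  also have "\<dots> = (if Suc q < length c then c ! Suc q else hd c)"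
    using q dc by (simp add: cycle_of_list_nth)
  finally have hat: "hat w (w ! p) = (if Suc q < length c then c ! Suc q else hd c)" .
  show ?thesis
  proof (cases "Suc q < length c")
    case True
    then have "w ! Suc p = c ! Suc q" "Suc p < length w"
      using nth[of "Suc q"] by (simp_all add: p b(1))
    with True hat tl[of "Suc q"] show ?thesis by simp
  next
    case False
    then have sq: "Suc q = length c" using q by simp
    have hd: "hd c = w ! length pre"
      using nth[of 0] b(2) by (simp add: hd_conv_nth)
    obtain s where s: "s \<le> p" "w ! s \<in> Lmax w" "\<forall>j\<le>p. w ! j \<le> w ! s"
      using Lmax_greatest_prefix[OF w(2)] .
    \<comment> \<open>If \<open>s\<close> came before the block, the head of the block, a
      left-to-right maximum at a position at most \<open>p\<close>, would exceed the maximum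
      \<open>w ! s\<close>.\<close>
    have "s \<ge> length pre"
    proof (rule ccontr)
      assume "\<not> s \<ge> length pre"
      then have l: "s < length pre" by simp
      then have "hd c \<in> Lmax w" using b(4) by auto
      then have "w ! s < w ! length pre"
        using Lmax_less[OF w(1) _ _ l] w(2) p hd by simp
      moreover have "w ! length pre \<le> w ! s"
        using s(3) p by simp
      ultimately show False by simp
    qed
    then obtain m where m: "s = length pre + m"
      using le_Suc_ex by blast
    then have "m < length c" using s(1) p q by simp
    with tl[of m] nth[of m] s(2) m have "m = 0" by auto
    with m hd have "hd c = w ! s" by simp
    moreover have "w ! Suc p \<in> Lmax w" if "Suc p < length w"
    proof -
      have sp: "Suc p = length (pre @ c)" using sq p by simp
      then have "post \<noteq> []" using that b(1) by auto
      moreover have "w ! Suc p = hd post"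
        using \<open>post \<noteq> []\<close> unfolding sp by (simp add: b(1) nth_append hd_conv_nth)
      ultimately show ?thesis using b(5) by simp
    qed
    ultimately show ?thesis using hat False s by simp
  qed
qed

text \<open>The larger letter at \<open>q\<close> keeps \<open>w ! Suc p\<close> from being a
  left-to-right maximum, so no cut separates the two letters.\<close>

lemma hat_nth_not_Lmax:
  assumes "distinct w" "Suc p < length w" "q \<le> p" "w ! Suc p < w ! q"
  shows "hat w (w ! p) = w ! Suc p"
proof -
  have "w ! Suc p \<notin> Lmax w"
    using Lmax_less[of w "Suc p" q] assms by auto
  then show ?thesis
    using hat_nth[of w p] assms by auto
qed

text \<open>If \<open>p\<close> ended its cycle, \<open>w ! s\<close> would be a left-to-right
  maximum bounding all letters up to \<open>p\<close>. The larger letter at \<open>q\<close>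
  contradicts the bound when \<open>q \<le> p\<close> and the maximum when \<open>q < s\<close>.
  Part (i) of the theorem uses \<open>q < s\<close>, part (ii) uses
  \<open>q \<le> p\<close>.\<close>

lemma hat_eq_imp_adjacent:
  assumes "distinct w" "p < length w" "s < length w" "hat w (w ! p) = w ! s"
    and "w ! s < w ! q" "q \<le> p \<or> q < s"
  shows "s = Suc p"
proof -
  have "\<not> (w ! s \<in> Lmax w \<and> (\<forall>j\<le>p. w ! j \<le> w ! s))"
  proof
    assume "w ! s \<in> Lmax w \<and> (\<forall>j\<le>p. w ! j \<le> w ! s)"
    then have "w ! q \<le> w ! s"
      using assms(6) Lmax_less[OF assms(1,3), of q] less_imp_le by blast
    then show False using assms(5) by simp
  qed
  then have "Suc p < length w" "w ! s = w ! Suc p"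
    using hat_nth[OF assms(1,2)] unfolding assms(4) by blast+
  then show ?thesis
    using assms(1,3) nth_eq_iff_index_eq by blast
qed

section \<open>Comparison of arrow and vincular patterns\<close>

text \<open>Replaces order isomorphism by an increasing enumeration \<open>x\<close> of the letters
  used, the form in which arrow patterns are defined, so that the two kinds of occurrence can be
  compared directly.\<close>

lemma vincular_contains_iff:
  assumes \<sigma>: "\<sigma> \<in> permutations_of_set {1..k}" and w: "w \<in> permutations_of_set {1..n}"
  shows "vincular_contains w (\<sigma>, J) \<longleftrightarrow> (\<exists>x t :: nat \<Rightarrow> nat.
     strict_mono_on {1..k} x \<and> x ` {1..k} \<subseteq> {1..length w} \<and>
     strict_mono_on {..<k} t \<and> t ` {..<k} \<subseteq> {..<length w} \<and>
     (\<forall>j<k. w ! t j = x (\<sigma> ! j)) \<and> (\<forall>j\<in>J. t (Suc j) = Suc (t j)))"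
    (is "?L \<longleftrightarrow> ?R")
proof
  have len: "length \<sigma> = k" "length w = n"
    using assms[THEN length_finite_permutations_of_set] by auto
  have sets: "set \<sigma> = {1..k}" "set w = {1..n}"
    using assms by (auto dest: permutations_of_setD)
  {
    assume ?L
    then obtain t where t: "strict_mono_on {..<k} t" "t ` {..<k} \<subseteq> {..<length w}"
      and ord: "\<And>a b. a < k \<Longrightarrow> b < k \<Longrightarrow> w ! t a < w ! t b \<longleftrightarrow> \<sigma> ! a < \<sigma> ! b"
      and J: "\<forall>j\<in>J. t (Suc j) = Suc (t j)"
      by (auto simp: vincular_contains_def len)
    have inj: "inj_on ((!) \<sigma>) {..<k}"
      using \<sigma> len by (auto simp: inj_on_def permutations_of_set_def nth_eq_iff_index_eq)
    have img: "(!) \<sigma> ` {..<k} = {1..k}"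
      unfolding sets(1)[symmetric] using len by (auto simp: set_conv_nth)
    \<comment> \<open>\<open>f\<close> inverts \<sigma>, from values in \<open>{1..k}\<close> to
      positions counted from 0; \<open>x m\<close> below is then the letter of \<open>w\<close> that
      plays the role of \<open>m\<close>.\<close>
    define f where "f = inv_into {..<k} ((!) \<sigma>)"
    have f: "f m < k" "\<sigma> ! f m = m" if "m \<in> {1..k}" for m
      using inv_into_into[of m "(!) \<sigma>" "{..<k}"] f_inv_into_f[of m "(!) \<sigma>" "{..<k}"] that
      unfolding img f_def by auto
    have fn: "f (\<sigma> ! j) = j" if "j < k" for j
      using that inj by (simp add: f_def inv_into_f_f)
    define x where "x m = w ! t (f m)" for m
    have "strict_mono_on {1..k} x"
      by (rule strict_mono_onI) (simp add: x_def ord f)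
    moreover have "x ` {1..k} \<subseteq> {1..length w}"
    proof
      fix y assume "y \<in> x ` {1..k}"
      then obtain m where m: "m \<in> {1..k}" "y = w ! t (f m)" by (auto simp: x_def)
      then have "t (f m) < length w" using t(2) f(1)[of m] by auto
      then have "y \<in> set w" using m by simp
      then show "y \<in> {1..length w}" by (simp add: sets len)
    qed
    moreover have "\<forall>j<k. w ! t j = x (\<sigma> ! j)"
      by (simp add: x_def fn)
    ultimately show ?R using t J by blast
  }
  {
    assume ?R
    then obtain x t where x: "strict_mono_on {1..k} x"
      and t: "strict_mono_on {..<k} t" "t ` {..<k} \<subseteq> {..<length w}"
      and eq: "\<And>j. j < k \<Longrightarrow> w ! t j = x (\<sigma> ! j)" and J: "\<forall>j\<in>J. t (Suc j) = Suc (t j)"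
      by blast
    have "w ! t a < w ! t b \<longleftrightarrow> \<sigma> ! a < \<sigma> ! b" if "a < k" "b < k" for a b
    proof -
      have "\<sigma> ! a \<in> {1..k}" "\<sigma> ! b \<in> {1..k}"
        using that len sets(1) nth_mem by metis+
      then show ?thesis
        using that by (simp add: eq strict_mono_on_less[OF x])
    qed
    then show ?L
      unfolding vincular_contains_def using t J by (auto simp: len)
  }
qed

text \<open>Deleting the letter at position \<open>q\<close>, one of the two adjacent ones, turns \<open>\<sigma>\<close> into \<open>\<nu>\<close>;
  \<open>q = i\<close> gives part (i) of the theorem and \<open>q = Suc i\<close> gives part (ii).\<close>

lemma arrow_contains_iff_vincular_contains:
  assumes \<sigma>: "\<sigma> \<in> permutations_of_set {1..k}" and w: "w \<in> permutations_of_set {1..n}"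
    and i: "Suc i < k" and q: "q = i \<or> q = Suc i"
    and l: "l < i" "\<sigma> ! Suc i < \<sigma> ! l"
    and \<nu>: "\<nu> = take q \<sigma> @ drop (Suc q) \<sigma>"
  shows "arrow_contains k w (\<nu>, {(\<sigma> ! i, \<sigma> ! Suc i)}) \<longleftrightarrow> vincular_contains w (\<sigma>, {i})"
    (is "?A \<longleftrightarrow> ?V")
proof -
  have len: "length \<sigma> = k" "length w = n"
    using \<sigma> w by (auto dest: length_finite_permutations_of_set)
  have dist: "distinct w" and setw: "set w = {1..n}" and sets: "set \<sigma> = {1..k}"
    and dists: "distinct \<sigma>"
    using \<sigma> w by (auto dest: permutations_of_setD)
  have len\<nu>: "length \<nu> = k - 1"
    using i q by (auto simp: \<nu> len)
  have \<nu>_nth: "\<nu> ! j = \<sigma> ! (if j < q then j else Suc j)" if "j < k - 1" for j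
    using that i q by (auto simp: \<nu> len nth_append min_def)
  have \<sigma>_mem: "\<sigma> ! j \<in> {1..k}" if "j < k" for j
    using that len sets nth_mem by metis
  show ?thesis
    unfolding vincular_contains_iff[OF \<sigma> w]
  proof
    assume ?A
    then obtain x t where x: "strict_mono_on {1..k} x" "x ` {1..k} \<subseteq> {1..length w}"
      and t: "strict_mono_on {..<k-1} t" "t ` {..<k-1} \<subseteq> {..<length w}"
      and eq: "\<And>j. j < k - 1 \<Longrightarrow> w ! t j = x (\<nu> ! j)"
      and hat: "hat w (x (\<sigma> ! i)) = x (\<sigma> ! Suc i)"
      by (auto simp: arrow_contains_def len\<nu>)
    have "x m \<in> set w" if "m \<in> {1..k}" for m
      using that x(2) unfolding len setw by blast
    then have "\<exists>p<length w. w ! p = x (\<sigma> ! j)" if "j < k" for j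
      using that \<sigma>_mem by (metis in_set_conv_nth)
    \<comment> \<open>\<open>pos j\<close> is the place in \<open>w\<close> of the letter standing
      for \<open>\<sigma> ! j\<close>. For \<open>j = q\<close> the arrow occurrence prescribes no
      place; the aim is that \<open>pos\<close> is nevertheless increasing.\<close>
    then obtain pos where pos: "\<And>j. j < k \<Longrightarrow> pos j < length w"
      "\<And>j. j < k \<Longrightarrow> w ! pos j = x (\<sigma> ! j)"
      by metis
    have xinj: "inj_on x {1..k}" by (rule strict_mono_on_imp_inj_on[OF x(1)])
    have pos_inj: "pos a \<noteq> pos b" if "a < k" "b < k" "a \<noteq> b" for a b
    proof -
      have "\<sigma> ! a \<noteq> \<sigma> ! b" using that dists len by (simp add: nth_eq_iff_index_eq)
      then have "x (\<sigma> ! a) \<noteq> x (\<sigma> ! b)"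
        using that xinj \<sigma>_mem by (simp add: inj_on_eq_iff)
      then show ?thesis using that pos by metis
    qed
    have t_pos: "t j = pos (if j < q then j else Suc j)" if "j < k - 1" for j
    proof -
      have "t j < length w" using t that by auto
      moreover have "w ! t j = w ! pos (if j < q then j else Suc j)"
        using that eq pos(2) by (simp add: \<nu>_nth)
      ultimately show ?thesis
        using dist pos(1) that by (simp add: nth_eq_iff_index_eq)
    qed
    have pos_mono: "pos a < pos b" if "a < b" "b < k" "a \<noteq> q" "b \<noteq> q" for a b
    proof -
      \<comment> \<open>The positions in \<nu> of the letters at \<open>a\<close> and
        \<open>b\<close> in \<sigma>: deleting position \<open>q\<close> shifts the later ones by
        one.\<close>
      define a' b' where "a' = (if a < q then a else a - 1)" and "b' = (if b < q then b else b - 1)"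
      have *: "a' < b'" "b' < k - 1" "(if a' < q then a' else Suc a') = a"
        "(if b' < q then b' else Suc b') = b"
        using that i q unfolding a'_def b'_def by auto
      then have "t a' < t b'" by (intro strict_mono_onD[OF t(1)]) simp_all
      moreover have "t a' = pos a" "t b' = pos b"
        using * t_pos[of a'] t_pos[of b'] by simp_all
      ultimately show ?thesis by simp
    qed
    have adj: "pos (Suc i) = Suc (pos i)"
    proof (rule hat_eq_imp_adjacent[OF dist])
      show "w ! pos (Suc i) < w ! pos l"
        using l i x(1) \<sigma>_mem pos by (simp add: strict_mono_on_less)
      show "pos l \<le> pos i \<or> pos l < pos (Suc i)"
        using q l i pos_mono[of l i] pos_mono[of l "Suc i"] by auto
    qed (use i pos hat in auto)
    have "pos a < pos b" if "a < b" "b < k" for a b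
    proof -
      \<comment> \<open>Only pairs involving \<open>q\<close> are new. Of \<open>i\<close> and
        \<open>Suc i\<close>, the one other than \<open>q\<close> is already ordered against all
        remaining positions; \<open>pos q\<close> is right next to it by \<open>adj\<close>, and
        \<open>pos_inj\<close> excludes a coincidence.\<close>
      consider "a \<noteq> q" "b \<noteq> q" | "a = i" "b = Suc i" | "a < i" "b = q" | "a = q" "b > Suc i"
        using \<open>a < b\<close> q by linarith
      then show ?thesis
      proof cases
        case 1
        then show ?thesis using that pos_mono by simp
      next
        case 2
        then show ?thesis by (simp add: adj)
      next
        case 3
        then show ?thesis
          using q pos_mono[of a i] pos_mono[of a "Suc i"] pos_inj[of a i] i adj by auto
      next
        case 4
        then show ?thesis
          using q pos_mono[of i b] pos_mono[of "Suc i" b] pos_inj[of "Suc i" b] i adj that by auto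
      qed
    qed
    then have "strict_mono_on {..<k} pos"
      by (intro strict_mono_onI) auto
    with x pos adj show "\<exists>x t. strict_mono_on {1..k} x \<and> x ` {1..k} \<subseteq> {1..length w} \<and>
       strict_mono_on {..<k} t \<and> t ` {..<k} \<subseteq> {..<length w} \<and>
       (\<forall>j<k. w ! t j = x (\<sigma> ! j)) \<and> (\<forall>j\<in>{i}. t (Suc j) = Suc (t j))"
      by (intro exI[of _ x] exI[of _ pos]) auto
  next
    assume "\<exists>x t. strict_mono_on {1..k} x \<and> x ` {1..k} \<subseteq> {1..length w} \<and>
       strict_mono_on {..<k} t \<and> t ` {..<k} \<subseteq> {..<length w} \<and>
       (\<forall>j<k. w ! t j = x (\<sigma> ! j)) \<and> (\<forall>j\<in>{i}. t (Suc j) = Suc (t j))"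
    then obtain x t where x: "strict_mono_on {1..k} x" "x ` {1..k} \<subseteq> {1..length w}"
      and t: "strict_mono_on {..<k} t" "t ` {..<k} \<subseteq> {..<length w}"
      and eq: "\<And>j. j < k \<Longrightarrow> w ! t j = x (\<sigma> ! j)" and adj: "t (Suc i) = Suc (t i)"
      by blast
    have "hat w (w ! t i) = w ! Suc (t i)"
    proof (rule hat_nth_not_Lmax[OF dist])
      show "Suc (t i) < length w" using t(2) i by (auto simp flip: adj)
      show "t l \<le> t i"
        using l i by (intro less_imp_le strict_mono_onD[OF t(1)]) auto
      show "w ! Suc (t i) < w ! t l"
        using l i x(1) \<sigma>_mem eq by (simp add: strict_mono_on_less flip: adj)
    qed
    then have hat: "hat w (x (\<sigma> ! i)) = x (\<sigma> ! Suc i)"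
      using eq i by (simp flip: adj)
    \<comment> \<open>Skipping index \<open>q\<close> restricts the occurrence of \<sigma> to one of
      \<nu>.\<close>
    define t' where "t' j = t (if j < q then j else Suc j)" for j
    have "strict_mono_on {..<k-1} t'"
      unfolding t'_def by (intro strict_mono_onI strict_mono_onD[OF t(1)]) auto
    moreover have "t' ` {..<k-1} \<subseteq> {..<length w}"
      unfolding t'_def using t(2) by (force simp: image_subset_iff)
    moreover have "\<forall>j<k-1. w ! t' j = x (\<nu> ! j)"
      unfolding t'_def using eq by (simp add: \<nu>_nth)
    ultimately show ?A
      unfolding arrow_contains_def using x hat by (auto simp: len\<nu>)
  qed
qed

section \<open>Avoidance classes for the two arrow directions\<close>

theorem lemma2p2:
  fixes n k r i :: nat and \<nu> :: "nat list"
  assumes "distinct \<nu>" and "set \<nu> \<subseteq> {1..k}" and "length \<nu> = k - 1"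
    and "{1..k} - set \<nu> = {r}"
    and "i < k - 1"
    and "n \<ge> 1"
  shows "(\<nu> ! i \<notin> Lmax \<nu> \<longrightarrow>
            arrow_avoiders n k (\<nu>, {(r, \<nu> ! i)}) =
              vincular_avoiders n (take i \<nu> @ [r, \<nu> ! i] @ drop (Suc i) \<nu>, {i})) \<and>
         (0 < i \<and> r < Max (set (take i \<nu>)) \<longrightarrow>
            arrow_avoiders n k (\<nu>, {(\<nu> ! i, r)}) =
              vincular_avoiders n (take i \<nu> @ [\<nu> ! i, r] @ drop (Suc i) \<nu>, {i}))"
proof (intro conjI impI)
  have i: "i < length \<nu>" "Suc i < k" using assms by auto
  have split: "\<nu> = take i \<nu> @ \<nu> ! i # drop (Suc i) \<nu>"
    using i(1) by (rule id_take_nth_drop)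
  note wf = patterns_wellformed(3,4)[OF assms(1-5)]
  {
    assume "\<nu> ! i \<notin> Lmax \<nu>"
    \<comment> \<open>A letter that is not a left-to-right maximum has an earlier letter at least as
      large, strictly larger by distinctness. This is the dominating letter required of
      \<sigma>.\<close>
    then obtain l where l: "l < i" "\<nu> ! i \<le> \<nu> ! l"
      using i by (auto simp: Lmax_def not_less)
    then have "\<nu> ! i < \<nu> ! l"
      using assms(1) i by (simp add: le_less nth_eq_iff_index_eq)
    let ?\<sigma> = "take i \<nu> @ [r, \<nu> ! i] @ drop (Suc i) \<nu>"
    have \<sigma>: "?\<sigma> \<in> permutations_of_set {1..k}"
      using wf(1) by (simp add: is_vincular_pattern_def)
    have nth: "?\<sigma> ! i = r" "?\<sigma> ! Suc i = \<nu> ! i" "?\<sigma> ! l = \<nu> ! l"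
      using i l by (simp_all add: nth_append)
    have "\<nu> = take i ?\<sigma> @ drop (Suc i) ?\<sigma>"
      using i split by simp
    then have "arrow_contains k w (\<nu>, {(r, \<nu> ! i)}) \<longleftrightarrow> vincular_contains w (?\<sigma>, {i})"
      if "w \<in> permutations_of_set {1..n}" for w
      using arrow_contains_iff_vincular_contains[OF \<sigma> that i(2), of i l \<nu>] \<open>\<nu> ! i < \<nu> ! l\<close> l(1)
      unfolding nth by blast
    then show "arrow_avoiders n k (\<nu>, {(r, \<nu> ! i)}) = vincular_avoiders n (?\<sigma>, {i})"
      unfolding arrow_avoiders_def vincular_avoiders_def by blast
  }
  {
    assume r: "0 < i \<and> r < Max (set (take i \<nu>))"
    \<comment> \<open>As \<open>0 < i\<close>, the prefix is nonempty and its maximum is attained;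
      the position where this happens serves as \<open>l\<close>.\<close>
    have "Max (set (take i \<nu>)) \<in> set (take i \<nu>)"
      using r i by (intro Max_in) auto
    then obtain l where l: "l < i" "r < \<nu> ! l"
      using r by (auto simp: in_set_conv_nth)
    let ?\<sigma> = "take i \<nu> @ [\<nu> ! i, r] @ drop (Suc i) \<nu>"
    have \<sigma>: "?\<sigma> \<in> permutations_of_set {1..k}"
      using wf(2) by (simp add: is_vincular_pattern_def)
    have nth: "?\<sigma> ! i = \<nu> ! i" "?\<sigma> ! Suc i = r" "?\<sigma> ! l = \<nu> ! l"
      using i l by (simp_all add: nth_append)
    have "\<nu> = take (Suc i) ?\<sigma> @ drop (Suc (Suc i)) ?\<sigma>"
      using i split by simp
    then have "arrow_contains k w (\<nu>, {(\<nu> ! i, r)}) \<longleftrightarrow> vincular_contains w (?\<sigma>, {i})"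
      if "w \<in> permutations_of_set {1..n}" for w
      using arrow_contains_iff_vincular_contains[OF \<sigma> that i(2), of "Suc i" l \<nu>] l
      unfolding nth by blast
    then show "arrow_avoiders n k (\<nu>, {(\<nu> ! i, r)}) = vincular_avoiders n (?\<sigma>, {i})"
      unfolding arrow_avoiders_def vincular_avoiders_def by blast
  }
qed

end
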